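(* Let $A$ be a covered semigroup. Then the prime ideals of $A$ are in bijection with the points of the frame $\operatorname{Spec}A$.
   Context: A covered semigroup is a semigroup $(A,\cdot)$ with a closure operator $[-]$ on $(\mathcal P(A),\subset)$ satisfying $[S]\cdot[T]\subset[S\cdot T]$ for all $S,T\subset A$, where $S\cdot T=\{s\cdot t\mid s\in S,t\in T\}$. A flat is a subset $C$ with $[C]=C$. An ideal of $A$ is a flat $I$ with $A\cdot I\subset I$ and $I\cdot A\subset I$. A prime ideal is an ideal $I\ne A$ such that $x\cdot y\in I\Rightarrow x\in I$ or $y\in I$. A suplattice is a poset with all suprema. A quantale is a suplattice with an associative multiplication distributing over arbitrary joins in each variable. The set $\mathcal C(A)$ of flats is a quantale with joins $[\bigcup_\alpha C_\alpha]$ and product $[C\cdot D]$. A frame is a suplattice in which binary meet distributes over arbitrary joins, regarded as a quantale with multiplication $\wedge$. A strong morphism of quantales is a map preserving arbitrary joins and products (units/top elements need not be preserved). For a quantale $\mathcal Q$, $\operatorname{Spec}\mathcal Q$ is the frame equipped with a strong morphism $\mathcal Q\to\operatorname{Spec}\mathcal Q$ initial among strong morphisms from $\mathcal Q$ to frames (this exists, by a theorem of Rosenthal). For a covered semigroup $A$, $\operatorname{Spec}A=\operatorname{Spec}\mathcal C(A)$. A point (prime) of a frame $\mathcal F$ is an element $P\in\mathcal F$, not the top element, such that $U\wedge V\le P\Rightarrow U\le P$ or $V\le P$. *)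

theory Defs
  imports "HOL-Algebra.Complete_Lattice" "HOL-Library.FuncSet"
begin

section \<open>Covered semigroups and their ideals\<close>

record 'a covered = "'a partial_object" +
  cmult :: "'a \<Rightarrow> 'a \<Rightarrow> 'a"  (infixl \<open>\<cdot>\<index>\<close> 70)
  cl :: "'a set \<Rightarrow> 'a set"

definition set_prod :: "('a, 'm) covered_scheme \<Rightarrow> 'a set \<Rightarrow> 'a set \<Rightarrow> 'a set"  (infixl \<open>\<odot>\<index>\<close> 70)
  where "S \<odot>\<^bsub>A\<^esub> T = {s \<cdot>\<^bsub>A\<^esub> t | s t. s \<in> S \<and> t \<in> T}"

text \<open>Only the values of \<^const>\<open>cl\<close> on subsets of the carrier are meaningful.\<close>

locale covered_semigroup =
  fixes A :: "'a covered" (structure)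
  assumes mult_closed: "\<lbrakk>x \<in> carrier A; y \<in> carrier A\<rbrakk> \<Longrightarrow> x \<cdot> y \<in> carrier A"
    and mult_assoc:
      "\<lbrakk>x \<in> carrier A; y \<in> carrier A; z \<in> carrier A\<rbrakk> \<Longrightarrow> (x \<cdot> y) \<cdot> z = x \<cdot> (y \<cdot> z)"
    and cl_closed: "S \<subseteq> carrier A \<Longrightarrow> cl A S \<subseteq> carrier A"
    and cl_extensive: "S \<subseteq> carrier A \<Longrightarrow> S \<subseteq> cl A S"
    and cl_mono: "\<lbrakk>S \<subseteq> T; T \<subseteq> carrier A\<rbrakk> \<Longrightarrow> cl A S \<subseteq> cl A T"
    and cl_idem: "S \<subseteq> carrier A \<Longrightarrow> cl A (cl A S) = cl A S"
    and cl_mult: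
      "\<lbrakk>S \<subseteq> carrier A; T \<subseteq> carrier A\<rbrakk> \<Longrightarrow> cl A S \<odot> cl A T \<subseteq> cl A (S \<odot> T)"

definition flats :: "'a covered \<Rightarrow> 'a set set"
  where "flats A = {C. C \<subseteq> carrier A \<and> cl A C = C}"

definition ideals :: "'a covered \<Rightarrow> 'a set set"
  where "ideals A = {I \<in> flats A. carrier A \<odot>\<^bsub>A\<^esub> I \<subseteq> I \<and> I \<odot>\<^bsub>A\<^esub> carrier A \<subseteq> I}"

definition prime_ideals :: "'a covered \<Rightarrow> 'a set set"
  where "prime_ideals A = {I \<in> ideals A. I \<noteq> carrier A \<and>
    (\<forall>x\<in>carrier A. \<forall>y\<in>carrier A. x \<cdot>\<^bsub>A\<^esub> y \<in> I \<longrightarrow> x \<in> I \<or> y \<in> I)}"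

section \<open>Suplattices, quantales and frames\<close>

locale suplattice = partial_order +
  assumes sup_exists: "S \<subseteq> carrier L \<Longrightarrow> \<exists>s. least L s (Upper L S)"

sublocale suplattice \<subseteq> complete_lattice
proof
  fix S assume S: "S \<subseteq> carrier L"
  show "\<exists>s. least L s (Upper L S)" by (rule sup_exists[OF S])
  obtain i where "least L i (Upper L (Lower L S))"
    using sup_exists[of "Lower L S"] by auto
  then have "greatest L i (Lower L S)"
    using S unfolding least_def greatest_def Upper_def Lower_def by blast
  then show "\<exists>i. greatest L i (Lower L S)" ..
qed

record 'q quantale = "'q gorder" +
  qmult :: "'q \<Rightarrow> 'q \<Rightarrow> 'q"  (infixl \<open>\<star>\<index>\<close> 70)

locale quantale = suplattice Q for Q :: "'q quantale" (structure) +
  assumes qmult_closed: "\<lbrakk>x \<in> carrier Q; y \<in> carrier Q\<rbrakk> \<Longrightarrow> x \<star> y \<in> carrier Q"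
    and qmult_assoc:
      "\<lbrakk>x \<in> carrier Q; y \<in> carrier Q; z \<in> carrier Q\<rbrakk> \<Longrightarrow> (x \<star> y) \<star> z = x \<star> (y \<star> z)"
    and qmult_sup: "\<lbrakk>x \<in> carrier Q; S \<subseteq> carrier Q\<rbrakk> \<Longrightarrow> x \<star> (\<Squnion>S) = \<Squnion>((\<lambda>s. x \<star> s) ` S)"
    and sup_qmult: "\<lbrakk>x \<in> carrier Q; S \<subseteq> carrier Q\<rbrakk> \<Longrightarrow> (\<Squnion>S) \<star> x = \<Squnion>((\<lambda>s. s \<star> x) ` S)"

locale frame = suplattice F for F :: "'f gorder" (structure) +
  assumes meet_sup: "\<lbrakk>x \<in> carrier F; S \<subseteq> carrier F\<rbrakk> \<Longrightarrow> x \<sqinter> (\<Squnion>S) = \<Squnion>((\<lambda>s. x \<sqinter> s) ` S)"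

definition frame_quantale :: "'f gorder \<Rightarrow> 'f quantale"
  where "frame_quantale F =
    \<lparr>carrier = carrier F, eq = eq F, le = le F, qmult = meet F\<rparr>"

definition points :: "'f gorder \<Rightarrow> 'f set"
  where "points F = {P \<in> carrier F. P \<noteq> \<top>\<^bsub>F\<^esub> \<and>
    (\<forall>U\<in>carrier F. \<forall>V\<in>carrier F. U \<sqinter>\<^bsub>F\<^esub> V \<sqsubseteq>\<^bsub>F\<^esub> P \<longrightarrow> U \<sqsubseteq>\<^bsub>F\<^esub> P \<or> V \<sqsubseteq>\<^bsub>F\<^esub> P)}"

definition flat_quantale :: "'a covered \<Rightarrow> 'a set quantale"
  where "flat_quantale A =
    \<lparr>carrier = flats A, eq = (=), le = (\<subseteq>), qmult = (\<lambda>C D. cl A (C \<odot>\<^bsub>A\<^esub> D))\<rparr>"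

text \<open>
  Morphisms are extensional functions, so that equality of morphisms is equality in HOL.
  \<^const>\<open>sup_pres\<close> includes the empty join; the top element need not be preserved.
\<close>

definition strong_hom :: "'q quantale \<Rightarrow> 'r quantale \<Rightarrow> ('q \<Rightarrow> 'r) set"
  where "strong_hom Q R = {f \<in> carrier Q \<rightarrow>\<^sub>E carrier R. sup_pres Q R f \<and>
    (\<forall>x\<in>carrier Q. \<forall>y\<in>carrier Q. f (x \<star>\<^bsub>Q\<^esub> y) = f x \<star>\<^bsub>R\<^esub> f y)}"

section \<open>The spectrum of a quantale\<close>

definition universal_to :: "'q quantale \<Rightarrow> 'f gorder \<Rightarrow> ('q \<Rightarrow> 'f) \<Rightarrow> 'g gorder \<Rightarrow> bool"
  where "universal_to Q S \<phi> F \<longleftrightarrow>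
    (\<forall>f\<in>strong_hom Q (frame_quantale F).
      \<exists>!g. g \<in> strong_hom (frame_quantale S) (frame_quantale F) \<and> compose (carrier Q) g \<phi> = f)"

text \<open>
  A HOL definition cannot quantify over the frames of all types. Initiality is therefore
  required against the frames carried by the type of \<open>Q\<close> and those carried by the type
  of \<open>S\<close>. This loses nothing: \<open>is_spectrum_universal\<close> below derives initiality against
  frames of an arbitrary type, and \<open>is_spectrum_exists\<close> gives existence.
\<close>

definition is_spectrum :: "'q quantale \<Rightarrow> 'f gorder \<Rightarrow> ('q \<Rightarrow> 'f) \<Rightarrow> bool"
  where "is_spectrum Q S \<phi> \<longleftrightarrow> frame S \<and> \<phi> \<in> strong_hom Q (frame_quantale S) \<and>
    (\<forall>F :: 'q gorder. frame F \<longrightarrow> universal_to Q S \<phi> F) \<and>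
    (\<forall>F :: 'f gorder. frame F \<longrightarrow> universal_to Q S \<phi> F)"

section \<open>The flats form a quantale\<close>

context covered_semigroup
begin

lemma set_prod_carrier: "\<lbrakk>S \<subseteq> carrier A; T \<subseteq> carrier A\<rbrakk> \<Longrightarrow> S \<odot> T \<subseteq> carrier A"
  by (auto simp: set_prod_def intro: mult_closed)

lemma set_prod_mono: "\<lbrakk>S \<subseteq> S'; T \<subseteq> T'\<rbrakk> \<Longrightarrow> S \<odot> T \<subseteq> S' \<odot> T'"
  by (auto simp: set_prod_def)

lemma set_prod_assoc:
  assumes "S \<subseteq> carrier A" "T \<subseteq> carrier A" "U \<subseteq> carrier A"
  shows "(S \<odot> T) \<odot> U = S \<odot> (T \<odot> U)"
proof (intro equalityI subsetI)
  fix x assume "x \<in> (S \<odot> T) \<odot> U"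
  then obtain s t u where *: "s \<in> S" "t \<in> T" "u \<in> U" "x = (s \<cdot> t) \<cdot> u"
    by (auto simp: set_prod_def)
  then have "x = s \<cdot> (t \<cdot> u)" using assms mult_assoc[of s t u] by auto
  then show "x \<in> S \<odot> (T \<odot> U)"
    using * unfolding set_prod_def by blast
next
  fix x assume "x \<in> S \<odot> (T \<odot> U)"
  then obtain s t u where *: "s \<in> S" "t \<in> T" "u \<in> U" "x = s \<cdot> (t \<cdot> u)"
    by (auto simp: set_prod_def)
  then have "x = (s \<cdot> t) \<cdot> u" using assms mult_assoc[of s t u] by (simp add: subset_iff)
  then show "x \<in> (S \<odot> T) \<odot> U"
    using * unfolding set_prod_def by blast
qed

lemma cl_flat: "S \<subseteq> carrier A \<Longrightarrow> cl A S \<in> flats A"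
  by (simp add: flats_def cl_closed cl_idem)

lemma cl_least: "\<lbrakk>S \<subseteq> C; C \<in> flats A\<rbrakk> \<Longrightarrow> cl A S \<subseteq> C"
  using cl_mono[of S C] by (auto simp: flats_def)

lemma cl_set_prod_cl:
  assumes "S \<subseteq> carrier A" "T \<subseteq> carrier A"
  shows "cl A (cl A S \<odot> cl A T) = cl A (S \<odot> T)"
proof
  show "cl A (cl A S \<odot> cl A T) \<subseteq> cl A (S \<odot> T)"
    using cl_least[OF cl_mult[OF assms] cl_flat[OF set_prod_carrier[OF assms]]] .
  show "cl A (S \<odot> T) \<subseteq> cl A (cl A S \<odot> cl A T)"
    by (intro cl_mono set_prod_mono set_prod_carrier cl_extensive cl_closed assms)
qed

lemma flats_carrier: "M \<subseteq> flats A \<Longrightarrow> \<Union>M \<subseteq> carrier A"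
  by (auto simp: flats_def)

lemma flat_lub:
  assumes M: "M \<subseteq> flats A"
  shows "least (flat_quantale A) (cl A (\<Union>M)) (Upper (flat_quantale A) M)"
proof -
  have "\<Union>M \<subseteq> cl A (\<Union>M)" "cl A (\<Union>M) \<in> flats A"
    using cl_extensive cl_flat flats_carrier[OF M] by blast+
  moreover have "cl A (\<Union>M) \<subseteq> C" if "C \<in> flats A" "\<And>D. D \<in> M \<Longrightarrow> D \<subseteq> C" for C
    using that by (intro cl_least) auto
  ultimately show ?thesis
    using M unfolding least_def Upper_def flat_quantale_def by (simp add: Ball_def) blast
qed

sublocale flat: suplattice "flat_quantale A"
  rewrites "carrier (flat_quantale A) = flats A"
    and "le (flat_quantale A) = (\<subseteq>)"
    and "qmult (flat_quantale A) = (\<lambda>C D. cl A (C \<odot> D))"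
proof -
  show "suplattice (flat_quantale A)"
  proof
    fix M assume "M \<subseteq> carrier (flat_quantale A)"
    then show "\<exists>s. least (flat_quantale A) s (Upper (flat_quantale A) M)"
      using flat_lub[of M] by (auto simp: flat_quantale_def)
  qed (auto simp: flat_quantale_def)
qed (simp_all add: flat_quantale_def)

lemma flat_sup: "M \<subseteq> flats A \<Longrightarrow> \<Squnion>\<^bsub>flat_quantale A\<^esub> M = cl A (\<Union>M)"
  by (meson flat.least_unique flat.sup_lub flat_lub)

lemma cl_UN_cl:
  assumes "\<And>i. i \<in> I \<Longrightarrow> X i \<subseteq> carrier A"
  shows "cl A (\<Union>i\<in>I. cl A (X i)) = cl A (\<Union>i\<in>I. X i)"
proof
  have U: "(\<Union>i\<in>I. X i) \<subseteq> carrier A" using assms by auto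
  have "cl A (X i) \<subseteq> cl A (\<Union>i\<in>I. X i)" if "i \<in> I" for i
    using that U by (intro cl_mono) auto
  then show "cl A (\<Union>i\<in>I. cl A (X i)) \<subseteq> cl A (\<Union>i\<in>I. X i)"
    by (intro cl_least cl_flat U) auto
  have "(\<Union>i\<in>I. X i) \<subseteq> (\<Union>i\<in>I. cl A (X i))" using cl_extensive assms by blast
  moreover have "(\<Union>i\<in>I. cl A (X i)) \<subseteq> carrier A" using cl_closed assms by blast
  ultimately show "cl A (\<Union>i\<in>I. X i) \<subseteq> cl A (\<Union>i\<in>I. cl A (X i))" by (rule cl_mono)
qed

theorem flat_quantale: "quantale (flat_quantale A)"
proof -
  have sub: "C \<subseteq> carrier A" and cl: "cl A C = C" if "C \<in> flats A" for C
    using that by (auto simp: flats_def)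
  have q: "cl A (C \<odot> D) \<in> flats A" if "C \<in> flats A" "D \<in> flats A" for C D
    using that by (intro cl_flat set_prod_carrier sub)
  have assoc: "cl A (cl A (C \<odot> D) \<odot> E) = cl A (C \<odot> cl A (D \<odot> E))"
    if "C \<in> flats A" "D \<in> flats A" "E \<in> flats A" for C D E
  proof -
    note s = that[THEN sub]
    have "cl A (cl A (C \<odot> D) \<odot> E) = cl A ((C \<odot> D) \<odot> E)"
      using cl_set_prod_cl[of "C \<odot> D" E] s cl[OF that(3)] by (simp add: set_prod_carrier)
    also have "\<dots> = cl A (C \<odot> (D \<odot> E))" using s by (simp add: set_prod_assoc)
    also have "\<dots> = cl A (C \<odot> cl A (D \<odot> E))"
      using cl_set_prod_cl[of C "D \<odot> E"] s cl[OF that(1)] by (simp add: set_prod_carrier)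
    finally show ?thesis .
  qed
  have l: "cl A (C \<odot> cl A (\<Union>M)) = cl A (\<Union>D\<in>M. cl A (C \<odot> D))"
    if "C \<in> flats A" "M \<subseteq> flats A" for C M
  proof -
    have "cl A (C \<odot> cl A (\<Union>M)) = cl A (C \<odot> \<Union>M)"
      using cl_set_prod_cl[of C "\<Union>M"] that sub cl flats_carrier by auto
    also have "C \<odot> \<Union>M = (\<Union>D\<in>M. C \<odot> D)" by (auto simp: set_prod_def)
    also have "cl A \<dots> = cl A (\<Union>D\<in>M. cl A (C \<odot> D))"
      using that sub by (intro cl_UN_cl[symmetric] set_prod_carrier) auto
    finally show ?thesis .
  qed
  have r: "cl A (cl A (\<Union>M) \<odot> C) = cl A (\<Union>D\<in>M. cl A (D \<odot> C))"
    if "C \<in> flats A" "M \<subseteq> flats A" for C M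
  proof -
    have "cl A (cl A (\<Union>M) \<odot> C) = cl A (\<Union>M \<odot> C)"
      using cl_set_prod_cl[of "\<Union>M" C] that sub cl flats_carrier by auto
    also have "\<Union>M \<odot> C = (\<Union>D\<in>M. D \<odot> C)" by (auto simp: set_prod_def)
    also have "cl A \<dots> = cl A (\<Union>D\<in>M. cl A (D \<odot> C))"
      using that sub by (intro cl_UN_cl[symmetric] set_prod_carrier) auto
    finally show ?thesis .
  qed
  have im: "(\<lambda>D. cl A (C \<odot> D)) ` M \<subseteq> flats A" "(\<lambda>D. cl A (D \<odot> C)) ` M \<subseteq> flats A"
    if "C \<in> flats A" "M \<subseteq> flats A" for C M
    using that q by auto
  have "quantale_axioms (flat_quantale A)"
    by unfold_locales (simp_all add: flat.sup_closed flat_sup im l r q assoc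
       flat_quantale_def[THEN arg_cong[where f = carrier], simplified]
       flat_quantale_def[THEN arg_cong[where f = qmult], simplified])
  then show ?thesis by (simp add: quantale_def flat.suplattice_axioms)
qed

end

section \<open>Existence and universality of the spectrum\<close>

lemma frame_quantale_simps [simp]:
  "carrier (frame_quantale F) = carrier F" "le (frame_quantale F) = le F"
  "eq (frame_quantale F) = eq F" "qmult (frame_quantale F) = meet F"
  "Upper (frame_quantale F) = Upper F" "Lower (frame_quantale F) = Lower F"
  "least (frame_quantale F) = least F" "greatest (frame_quantale F) = greatest F"
  "Lattice.sup (frame_quantale F) = Lattice.sup F"
  by (simp_all add: frame_quantale_def Upper_def Lower_def least_def greatest_def Lattice.sup_def fun_eq_iff)

lemma frame_quantale_complete:
  assumes "frame F" shows "complete_lattice (frame_quantale F)"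
proof -
  interpret frame F by fact
  show ?thesis
    by unfold_locales
      (use le_trans sup_exists inf_exists in
        \<open>auto simp: eq_is_equal\<close>)
qed

lemma strong_homD:
  assumes "f \<in> strong_hom Q R"
  shows "x \<in> carrier Q \<Longrightarrow> f x \<in> carrier R"
    and "M \<subseteq> carrier Q \<Longrightarrow> f (\<Squnion>\<^bsub>Q\<^esub>M) = \<Squnion>\<^bsub>R\<^esub>(f ` M)"
    and "\<lbrakk>x \<in> carrier Q; y \<in> carrier Q\<rbrakk> \<Longrightarrow> f (x \<star>\<^bsub>Q\<^esub> y) = f x \<star>\<^bsub>R\<^esub> f y"
    and "f \<in> extensional (carrier Q)"
  using assms by (auto simp: strong_hom_def sup_pres_def PiE_def)


lemma strong_hom_compose:
  assumes Q: "quantale Q" and f: "f \<in> strong_hom Q R" and g: "g \<in> strong_hom R T"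
  shows "compose (carrier Q) g f \<in> strong_hom Q T"
proof -
  interpret Q: quantale Q by fact
  note F = strong_homD[OF f] and G = strong_homD[OF g]
  have im: "f ` M \<subseteq> carrier R" if "M \<subseteq> carrier Q" for M using F(1) that by auto
  have "compose (carrier Q) g f (\<Squnion>\<^bsub>Q\<^esub>M) = \<Squnion>\<^bsub>T\<^esub>(compose (carrier Q) g f ` M)"
    if M: "M \<subseteq> carrier Q" for M
  proof -
    have "compose (carrier Q) g f ` M = g ` f ` M"
      using M by (force simp: compose_eq)
    then show ?thesis using M by (simp add: compose_eq F(2) G(2) im)
  qed
  moreover have "complete_lattice T" using g by (simp add: strong_hom_def sup_pres_def)
  ultimately show ?thesis
    using F G Q.qmult_closed Q.complete_lattice_axioms
    by (simp add: strong_hom_def sup_pres_def compose_eq compose_extensional PiE_def)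
qed

lemma frame_is_quantale:
  assumes "frame F" shows "quantale (frame_quantale F)"
proof -
  interpret F: frame F by fact
  interpret q: complete_lattice "frame_quantale F" by (rule frame_quantale_complete[OF assms])
  have comm: "x \<sqinter>\<^bsub>F\<^esub> y = y \<sqinter>\<^bsub>F\<^esub> x" for x y by (simp add: meet_def insert_commute)
  have "(\<Squnion>\<^bsub>F\<^esub>M) \<sqinter>\<^bsub>F\<^esub> x = \<Squnion>\<^bsub>F\<^esub>((\<lambda>s. s \<sqinter>\<^bsub>F\<^esub> x) ` M)"
    if "x \<in> carrier F" "M \<subseteq> carrier F" for x M
    using F.meet_sup[OF that] by (simp add: comm)
  then show ?thesis
    by unfold_locales
      (use q.sup_exists in \<open>simp_all add: F.meet_assoc F.meet_sup F.sup_exists\<close>)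
qed

text \<open>
  The spectrum is realised on the elements \<open>q\<close> for which products below \<open>q\<close> may, in every
  context, be permuted, contracted and enlarged.
\<close>

inductive_set contexts :: "'q quantale \<Rightarrow> ('q \<Rightarrow> 'q) set" for Q :: "'q quantale" where
  ctx_id: "(\<lambda>z. z) \<in> contexts Q"
| ctx_l: "\<lbrakk>k \<in> contexts Q; c \<in> carrier Q\<rbrakk> \<Longrightarrow> (\<lambda>z. c \<star>\<^bsub>Q\<^esub> k z) \<in> contexts Q"
| ctx_r: "\<lbrakk>k \<in> contexts Q; c \<in> carrier Q\<rbrakk> \<Longrightarrow> (\<lambda>z. k z \<star>\<^bsub>Q\<^esub> c) \<in> contexts Q"

context quantale
begin

abbreviation "ctx \<equiv> contexts Q"

definition localic :: "'q set" where
  "localic = {q \<in> carrier Q. \<forall>k\<in>ctx. \<forall>a\<in>carrier Q. \<forall>b\<in>carrier Q.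
    (k (a \<star> b) \<sqsubseteq> q \<longrightarrow> k (b \<star> a) \<sqsubseteq> q) \<and> (k (a \<star> a) \<sqsubseteq> q \<longrightarrow> k a \<sqsubseteq> q) \<and>
    (k a \<sqsubseteq> q \<longrightarrow> k (a \<star> b) \<sqsubseteq> q)}"

definition nuc :: "'q \<Rightarrow> 'q" where
  "nuc = (\<lambda>a\<in>carrier Q. \<Sqinter>{q \<in> localic. a \<sqsubseteq> q})"

definition Spc :: "'q gorder" where
  "Spc = \<lparr>carrier = localic, eq = (=), le = le Q\<rparr>"

lemma ctx_closed: "k \<in> ctx \<Longrightarrow> z \<in> carrier Q \<Longrightarrow> k z \<in> carrier Q"
  by (induction rule: contexts.induct) (simp_all add: qmult_closed)

lemma localic_carrier: "localic \<subseteq> carrier Q"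
  unfolding localic_def by (rule Collect_restrict)

lemma localicI:
  assumes "q \<in> carrier Q"
    and "\<And>k a b. \<lbrakk>k \<in> ctx; a \<in> carrier Q; b \<in> carrier Q; k (a \<star> b) \<sqsubseteq> q\<rbrakk> \<Longrightarrow> k (b \<star> a) \<sqsubseteq> q"
    and "\<And>k a. \<lbrakk>k \<in> ctx; a \<in> carrier Q; k (a \<star> a) \<sqsubseteq> q\<rbrakk> \<Longrightarrow> k a \<sqsubseteq> q"
    and "\<And>k a b. \<lbrakk>k \<in> ctx; a \<in> carrier Q; b \<in> carrier Q; k a \<sqsubseteq> q\<rbrakk> \<Longrightarrow> k (a \<star> b) \<sqsubseteq> q"
  shows "q \<in> localic"
  unfolding localic_def mem_Collect_eq
proof (intro conjI ballI impI)
  show "q \<in> carrier Q" by (rule assms(1))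
  fix k a b assume k: "k \<in> ctx" and a: "a \<in> carrier Q" and b: "b \<in> carrier Q"
  show "k (b \<star> a) \<sqsubseteq> q" if "k (a \<star> b) \<sqsubseteq> q" by (rule assms(2)[OF k a b that])
  show "k a \<sqsubseteq> q" if "k (a \<star> a) \<sqsubseteq> q" by (rule assms(3)[OF k a that])
  show "k (a \<star> b) \<sqsubseteq> q" if "k a \<sqsubseteq> q" by (rule assms(4)[OF k a b that])
qed

lemma localicD:
  assumes "q \<in> localic" "k \<in> ctx" "a \<in> carrier Q" "b \<in> carrier Q"
  shows "k (a \<star> b) \<sqsubseteq> q \<Longrightarrow> k (b \<star> a) \<sqsubseteq> q" "k (a \<star> a) \<sqsubseteq> q \<Longrightarrow> k a \<sqsubseteq> q"
    "k a \<sqsubseteq> q \<Longrightarrow> k (a \<star> b) \<sqsubseteq> q"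
proof -
  have *: "\<forall>k\<in>ctx. \<forall>a\<in>carrier Q. \<forall>b\<in>carrier Q.
    (k (a \<star> b) \<sqsubseteq> q \<longrightarrow> k (b \<star> a) \<sqsubseteq> q) \<and> (k (a \<star> a) \<sqsubseteq> q \<longrightarrow> k a \<sqsubseteq> q) \<and>
    (k a \<sqsubseteq> q \<longrightarrow> k (a \<star> b) \<sqsubseteq> q)"
    using assms(1) unfolding localic_def mem_Collect_eq by (rule conjunct2)
  note 1 = bspec[OF bspec[OF bspec[OF * assms(2)] assms(3)] assms(4)]
  show "k (a \<star> b) \<sqsubseteq> q \<Longrightarrow> k (b \<star> a) \<sqsubseteq> q" using conjunct1[OF 1] by (rule mp)
  show "k (a \<star> a) \<sqsubseteq> q \<Longrightarrow> k a \<sqsubseteq> q" using conjunct1[OF conjunct2[OF 1]] by (rule mp)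
  show "k a \<sqsubseteq> q \<Longrightarrow> k (a \<star> b) \<sqsubseteq> q" using conjunct2[OF conjunct2[OF 1]] by (rule mp)
qed

lemma le_inf_iff: "\<lbrakk>M \<subseteq> carrier Q; x \<in> carrier Q\<rbrakk> \<Longrightarrow> x \<sqsubseteq> \<Sqinter>M \<longleftrightarrow> (\<forall>m\<in>M. x \<sqsubseteq> m)"
proof
  assume M: "M \<subseteq> carrier Q" and x: "x \<in> carrier Q"
  show "\<forall>m\<in>M. x \<sqsubseteq> m" if "x \<sqsubseteq> \<Sqinter>M"
    using that M x inf_lower[OF M] le_trans[of x "\<Sqinter>M"] inf_closed[OF M] by blast
  show "x \<sqsubseteq> \<Sqinter>M" if "\<forall>m\<in>M. x \<sqsubseteq> m"
    using that M x by (intro inf_greatest) (auto simp: Lower_def)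
qed

lemma sup_le_iff: "\<lbrakk>M \<subseteq> carrier Q; x \<in> carrier Q\<rbrakk> \<Longrightarrow> \<Squnion>M \<sqsubseteq> x \<longleftrightarrow> (\<forall>m\<in>M. m \<sqsubseteq> x)"
proof
  assume M: "M \<subseteq> carrier Q" and x: "x \<in> carrier Q"
  show "\<forall>m\<in>M. m \<sqsubseteq> x" if "\<Squnion>M \<sqsubseteq> x"
    using that M x sup_upper[OF M] le_trans[of _ "\<Squnion>M" x] sup_closed[OF M] by blast
  show "\<Squnion>M \<sqsubseteq> x" if "\<forall>m\<in>M. m \<sqsubseteq> x"
    using that M x by (intro sup_least) (auto simp: Upper_def)
qed

lemma localic_inf:
  assumes M: "M \<subseteq> localic" shows "\<Sqinter>M \<in> localic"
proof (rule localicI)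
  have M': "M \<subseteq> carrier Q" using M localic_carrier by (rule subset_trans)
  show "\<Sqinter>M \<in> carrier Q" by (rule inf_closed[OF M'])
  have L: "m \<in> localic" if "m \<in> M" for m using that M by (rule rev_subsetD)
  fix k a b assume k: "k \<in> ctx" and a: "a \<in> carrier Q" and b: "b \<in> carrier Q"
  show "k (b \<star> a) \<sqsubseteq> \<Sqinter>M" if "k (a \<star> b) \<sqsubseteq> \<Sqinter>M"
    using that localicD(1)[OF L k a b] by (simp add: le_inf_iff M' ctx_closed k a b qmult_closed)
  show "k a \<sqsubseteq> \<Sqinter>M" if "k (a \<star> a) \<sqsubseteq> \<Sqinter>M"
    using that localicD(2)[OF L k a a] by (simp add: le_inf_iff M' ctx_closed k a qmult_closed)
  show "k (a \<star> b) \<sqsubseteq> \<Sqinter>M" if "k a \<sqsubseteq> \<Sqinter>M"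
    using that localicD(3)[OF L k a b] by (simp add: le_inf_iff M' ctx_closed k a b qmult_closed)
qed

lemma nuc_localic: "a \<in> carrier Q \<Longrightarrow> nuc a \<in> localic"
  by (auto simp: nuc_def intro: localic_inf)

lemma nuc_carrier: "a \<in> carrier Q \<Longrightarrow> nuc a \<in> carrier Q"
  using nuc_localic localic_carrier by blast

lemma nuc_le_iff:
  assumes a: "a \<in> carrier Q" and q: "q \<in> localic"
  shows "nuc a \<sqsubseteq> q \<longleftrightarrow> a \<sqsubseteq> q"
proof -
  have M: "{q \<in> localic. a \<sqsubseteq> q} \<subseteq> carrier Q" using localic_carrier by auto
  have "a \<sqsubseteq> nuc a" using a M by (simp add: nuc_def le_inf_iff)
  moreover have "nuc a \<sqsubseteq> q" if "a \<sqsubseteq> q"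
    using that a q M by (auto simp: nuc_def intro!: inf_lower)
  ultimately show ?thesis
    using a q nuc_carrier[OF a] localic_carrier le_trans by blast
qed

lemma le_nuc: "a \<in> carrier Q \<Longrightarrow> a \<sqsubseteq> nuc a"
  using nuc_le_iff[of a "nuc a"] nuc_localic nuc_carrier by auto

lemma nuc_fix: "q \<in> localic \<Longrightarrow> nuc q = q"
  using nuc_le_iff[of q q] le_nuc localic_carrier nuc_carrier
  by (metis le_antisym le_refl subset_eq)

lemma qmult_mono_l:
  assumes "x \<sqsubseteq> y" "x \<in> carrier Q" "y \<in> carrier Q" "c \<in> carrier Q"
  shows "c \<star> x \<sqsubseteq> c \<star> y"
proof -
  have "\<Squnion>{x, y} = y"
    using assms by (intro le_antisym) (auto simp: sup_le_iff intro!: sup_upper)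
  then have "c \<star> y = \<Squnion>((\<lambda>s. c \<star> s) ` {x, y})" using assms qmult_sup[of c "{x, y}"] by auto
  then show ?thesis using assms sup_upper[of "(\<lambda>s. c \<star> s) ` {x, y}" "c \<star> x"]
    by (auto simp: qmult_closed)
qed

lemma qmult_mono_r:
  assumes "x \<sqsubseteq> y" "x \<in> carrier Q" "y \<in> carrier Q" "c \<in> carrier Q"
  shows "x \<star> c \<sqsubseteq> y \<star> c"
proof -
  have "\<Squnion>{x, y} = y"
    using assms by (intro le_antisym) (auto simp: sup_le_iff intro!: sup_upper)
  then have "y \<star> c = \<Squnion>((\<lambda>s. s \<star> c) ` {x, y})" using assms sup_qmult[of c "{x, y}"] by auto
  then show ?thesis using assms sup_upper[of "(\<lambda>s. s \<star> c) ` {x, y}" "x \<star> c"]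
    by (auto simp: qmult_closed)
qed

lemma residual_l:
  assumes q: "q \<in> localic" and c: "c \<in> carrier Q"
  obtains r where "r \<in> localic" "\<And>z. z \<in> carrier Q \<Longrightarrow> z \<sqsubseteq> r \<longleftrightarrow> c \<star> z \<sqsubseteq> q"
proof -
  define r where "r = \<Squnion>{z \<in> carrier Q. c \<star> z \<sqsubseteq> q}"
  have rc: "r \<in> carrier Q" and qc: "q \<in> carrier Q"
    using q localic_carrier by (auto simp: r_def)
  have "c \<star> r \<sqsubseteq> q"
    using c qc by (auto simp: r_def qmult_sup intro!: sup_least qmult_closed simp: Upper_def)
  then have *: "z \<sqsubseteq> r \<longleftrightarrow> c \<star> z \<sqsubseteq> q" if z: "z \<in> carrier Q" for z
    using z rc qc c qmult_mono_l[of z r c] le_trans[of "c \<star> z" "c \<star> r" q] qmult_closed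
    by (auto simp: r_def intro!: sup_upper)
  have "r \<in> localic"
  proof (rule localicI)
    fix k a b assume k: "k \<in> ctx" and a: "a \<in> carrier Q" and b: "b \<in> carrier Q"
    note D = localicD[OF q contexts.ctx_l[OF k c] a]
    show "k (b \<star> a) \<sqsubseteq> r" if "k (a \<star> b) \<sqsubseteq> r"
      using that D(1)[OF b] by (simp add: * ctx_closed k a b qmult_closed)
    show "k a \<sqsubseteq> r" if "k (a \<star> a) \<sqsubseteq> r"
      using that D(2)[OF a] by (simp add: * ctx_closed k a qmult_closed)
    show "k (a \<star> b) \<sqsubseteq> r" if "k a \<sqsubseteq> r"
      using that D(3)[OF b] by (simp add: * ctx_closed k a b qmult_closed)
  qed (rule rc)
  then show ?thesis using * that by blast
qed

lemma residual_r:
  assumes q: "q \<in> localic" and c: "c \<in> carrier Q"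
  obtains r where "r \<in> localic" "\<And>z. z \<in> carrier Q \<Longrightarrow> z \<sqsubseteq> r \<longleftrightarrow> z \<star> c \<sqsubseteq> q"
proof -
  define r where "r = \<Squnion>{z \<in> carrier Q. z \<star> c \<sqsubseteq> q}"
  have rc: "r \<in> carrier Q" and qc: "q \<in> carrier Q"
    using q localic_carrier by (auto simp: r_def)
  have "r \<star> c \<sqsubseteq> q"
    using c qc by (auto simp: r_def sup_qmult intro!: sup_least qmult_closed simp: Upper_def)
  then have *: "z \<sqsubseteq> r \<longleftrightarrow> z \<star> c \<sqsubseteq> q" if z: "z \<in> carrier Q" for z
    using z rc qc c qmult_mono_r[of z r c] le_trans[of "z \<star> c" "r \<star> c" q] qmult_closed
    by (auto simp: r_def intro!: sup_upper)
  have "r \<in> localic"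
  proof (rule localicI)
    fix k a b assume k: "k \<in> ctx" and a: "a \<in> carrier Q" and b: "b \<in> carrier Q"
    note D = localicD[OF q contexts.ctx_r[OF k c] a]
    show "k (b \<star> a) \<sqsubseteq> r" if "k (a \<star> b) \<sqsubseteq> r"
      using that D(1)[OF b] by (simp add: * ctx_closed k a b qmult_closed)
    show "k a \<sqsubseteq> r" if "k (a \<star> a) \<sqsubseteq> r"
      using that D(2)[OF a] by (simp add: * ctx_closed k a qmult_closed)
    show "k (a \<star> b) \<sqsubseteq> r" if "k a \<sqsubseteq> r"
      using that D(3)[OF b] by (simp add: * ctx_closed k a b qmult_closed)
  qed (rule rc)
  then show ?thesis using * that by blast
qed

lemma Spc_simps [simp]: "carrier Spc = localic" "le Spc = le Q" "eq Spc = (=)"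
  by (simp_all add: Spc_def)

lemma Spc_lub:
  assumes M: "M \<subseteq> localic"
  shows "least Spc (nuc (\<Squnion>M)) (Upper Spc M)"
proof -
  have M': "M \<subseteq> carrier Q" using M localic_carrier by auto
  have "m \<sqsubseteq> nuc (\<Squnion>M)" if "m \<in> M" for m
    using that M' le_nuc[of "\<Squnion>M"] sup_upper[OF M' that]
      le_trans[of m "\<Squnion>M" "nuc (\<Squnion>M)"] nuc_carrier by auto
  moreover have "nuc (\<Squnion>M) \<sqsubseteq> x" if "x \<in> localic" "\<And>m. m \<in> M \<Longrightarrow> m \<sqsubseteq> x" for x
    using that M' localic_carrier by (auto simp: nuc_le_iff sup_le_iff)
  ultimately show ?thesis
    using M M' by (auto simp: least_def Upper_def nuc_localic subset_iff)
qed

sublocale Spc: suplattice Spc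
proof unfold_locales
  have c: "x \<in> carrier Q" if "x \<in> localic" for x using that localic_carrier by auto
  fix x y z w assume xy: "x \<in> carrier Spc" "y \<in> carrier Spc"
  note c = xy[simplified, THEN c] c
  show "x \<sqsubseteq>\<^bsub>Spc\<^esub> x" using c by simp
  show "x .=\<^bsub>Spc\<^esub> y" if "x \<sqsubseteq>\<^bsub>Spc\<^esub> y" "y \<sqsubseteq>\<^bsub>Spc\<^esub> x"
    using that c by (simp add: le_antisym)
  show "x \<sqsubseteq>\<^bsub>Spc\<^esub> z" if "x \<sqsubseteq>\<^bsub>Spc\<^esub> y" "y \<sqsubseteq>\<^bsub>Spc\<^esub> z" "z \<in> carrier Spc"
    using that c le_trans[of x y z] by simp
next
  fix M assume "M \<subseteq> carrier Spc"
  then show "\<exists>s. least Spc s (Upper Spc M)" using Spc_lub[of M] by auto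
qed simp_all

lemma Spc_sup: "M \<subseteq> localic \<Longrightarrow> \<Squnion>\<^bsub>Spc\<^esub>M = nuc (\<Squnion>M)"
  by (metis Spc.least_unique Spc.sup_lub Spc_lub Spc_simps(1))

lemma nuc_mult_le_iff:
  assumes a: "a \<in> carrier Q" and b: "b \<in> carrier Q" and q: "q \<in> localic"
  shows "a \<star> b \<sqsubseteq> q \<longleftrightarrow> nuc a \<star> nuc b \<sqsubseteq> q"
proof -
  obtain r where r: "r \<in> localic" "\<And>z. z \<in> carrier Q \<Longrightarrow> z \<sqsubseteq> r \<longleftrightarrow> z \<star> b \<sqsubseteq> q"
    using residual_r[OF q b] by blast
  obtain l where l: "l \<in> localic" "\<And>z. z \<in> carrier Q \<Longrightarrow> z \<sqsubseteq> l \<longleftrightarrow> nuc a \<star> z \<sqsubseteq> q"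
    using residual_l[OF q nuc_carrier[OF a]] by blast
  show ?thesis
    using r l nuc_le_iff[OF a r(1)] nuc_le_iff[OF b l(1)] a b nuc_carrier by auto
qed

lemma nuc_mult:
  assumes a: "a \<in> carrier Q" and b: "b \<in> carrier Q"
  shows "nuc (a \<star> b) = nuc a \<sqinter>\<^bsub>Spc\<^esub> nuc b"
proof -
  let ?m = "nuc a \<sqinter>\<^bsub>Spc\<^esub> nuc b"
  have loc: "nuc a \<in> localic" "nuc b \<in> localic" "nuc (a \<star> b) \<in> localic"
    using a b by (auto intro: nuc_localic qmult_closed)
  have m: "?m \<in> localic" "?m \<sqsubseteq> nuc a" "?m \<sqsubseteq> nuc b"
    using Spc.meet_closed Spc.meet_left Spc.meet_right loc by auto
  have c: "a \<star> b \<in> carrier Q" "?m \<in> carrier Q" "nuc (a \<star> b) \<in> carrier Q"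
      "nuc a \<in> carrier Q" "nuc b \<in> carrier Q"
    using a b loc m localic_carrier qmult_closed by auto
  have "a \<star> b \<sqsubseteq> nuc a" using localicD(3)[OF loc(1) contexts.ctx_id a b] le_nuc[OF a] by simp
  moreover have "a \<star> b \<sqsubseteq> nuc b"
    using localicD(3)[OF loc(2) contexts.ctx_id b a] localicD(1)[OF loc(2) contexts.ctx_id b a] le_nuc[OF b] by simp
  ultimately have 1: "nuc (a \<star> b) \<sqsubseteq> ?m"
    using Spc.meet_le[of "nuc (a \<star> b)" "nuc a" "nuc b"] loc c by (simp add: nuc_le_iff)
  have "nuc a \<star> nuc b \<sqsubseteq> nuc (a \<star> b)"
    using nuc_mult_le_iff[OF a b loc(3)] le_nuc c by simp
  moreover have "?m \<star> ?m \<sqsubseteq> nuc a \<star> nuc b"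
    using qmult_mono_l[OF m(3), of ?m] qmult_mono_r[OF m(2), of "nuc b"] c qmult_closed le_trans
    by meson
  ultimately have "?m \<star> ?m \<sqsubseteq> nuc (a \<star> b)"
    using c qmult_closed le_trans by meson
  then have "?m \<sqsubseteq> nuc (a \<star> b)" using localicD(2)[OF loc(3) contexts.ctx_id c(2) c(2)] by simp
  with 1 show ?thesis using c by (intro le_antisym) auto
qed

lemma nuc_sup:
  assumes M: "M \<subseteq> carrier Q"
  shows "nuc (\<Squnion>M) = \<Squnion>\<^bsub>Spc\<^esub>(nuc ` M)"
proof -
  have im: "nuc ` M \<subseteq> localic" using M nuc_localic by auto
  have "least Spc (nuc (\<Squnion>M)) (Upper Spc (nuc ` M))"
  proof (rule least_UpperI)
    fix x assume "x \<in> nuc ` M"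
    then obtain m where m: "m \<in> M" "x = nuc m" by auto
    have "m \<sqsubseteq> nuc (\<Squnion>M)"
      using m M le_nuc[of "\<Squnion>M"] sup_upper[OF M m(1)]
        le_trans[of m "\<Squnion>M" "nuc (\<Squnion>M)"] nuc_carrier by auto
    moreover have "m \<in> carrier Q" "nuc (\<Squnion>M) \<in> localic" using m M by (auto intro: nuc_localic)
    ultimately show "x \<sqsubseteq>\<^bsub>Spc\<^esub> nuc (\<Squnion>M)" using m by (simp add: nuc_le_iff)
  next
    fix y assume "y \<in> Upper Spc (nuc ` M)"
    then have y: "y \<in> localic" "\<And>m. m \<in> M \<Longrightarrow> nuc m \<sqsubseteq> y"
      using im by (auto simp: Upper_def)
    then show "nuc (\<Squnion>M) \<sqsubseteq>\<^bsub>Spc\<^esub> y"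
      using M localic_carrier nuc_le_iff by (auto simp: nuc_le_iff sup_le_iff subset_iff)
  qed (use im M nuc_localic in auto)
  then show ?thesis using im Spc.sup_lub Spc.least_unique by (metis Spc_simps(1))
qed

sublocale Spc: frame Spc
proof
  fix x M assume x: "x \<in> carrier Spc" and M: "M \<subseteq> carrier Spc"
  have x': "x \<in> carrier Q" and M': "M \<subseteq> carrier Q" using x M localic_carrier by auto
  have "x \<sqinter>\<^bsub>Spc\<^esub> \<Squnion>\<^bsub>Spc\<^esub> M = nuc x \<sqinter>\<^bsub>Spc\<^esub> nuc (\<Squnion>M)"
    using x M by (simp add: nuc_fix Spc_sup)
  also have "\<dots> = nuc (\<Squnion>((\<lambda>s. x \<star> s) ` M))"
    using x' M' by (simp add: nuc_mult[symmetric] qmult_sup)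
  also have "\<dots> = \<Squnion>\<^bsub>Spc\<^esub>(nuc ` (\<lambda>s. x \<star> s) ` M)"
    using x' M' qmult_closed by (intro nuc_sup) auto
  also have "nuc ` (\<lambda>s. x \<star> s) ` M = (\<lambda>s. x \<sqinter>\<^bsub>Spc\<^esub> s) ` M"
    unfolding image_image using x M x' M'
    by (intro image_cong refl) (auto simp: nuc_mult nuc_fix subset_iff)
  finally show "x \<sqinter>\<^bsub>Spc\<^esub> \<Squnion>\<^bsub>Spc\<^esub> M = \<Squnion>\<^bsub>Spc\<^esub> ((\<lambda>s. x \<sqinter>\<^bsub>Spc\<^esub> s) ` M)" .
qed

lemma nuc_strong: "nuc \<in> strong_hom Q (frame_quantale Spc)"
  using complete_lattice_axioms frame_quantale_complete[OF Spc.frame_axioms]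
  by (auto simp: strong_hom_def sup_pres_def nuc_localic nuc_mult nuc_sup)
    (simp add: nuc_def)

lemma adjoint_localic:
  assumes F: "frame F" and f: "f \<in> strong_hom Q (frame_quantale F)" and u: "u \<in> carrier F"
  obtains r where "r \<in> localic" "\<And>z. z \<in> carrier Q \<Longrightarrow> z \<sqsubseteq> r \<longleftrightarrow> f z \<sqsubseteq>\<^bsub>F\<^esub> u"
proof -
  interpret F: frame F by fact
  note f = strong_homD[OF f, simplified]
  define r where "r = \<Squnion>{z \<in> carrier Q. f z \<sqsubseteq>\<^bsub>F\<^esub> u}"
  have rc: "r \<in> carrier Q" by (auto simp: r_def)
  have mono: "f x \<sqsubseteq>\<^bsub>F\<^esub> f y" if "x \<sqsubseteq> y" "x \<in> carrier Q" "y \<in> carrier Q" for x y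
  proof -
    have "\<Squnion>{x, y} = y"
      using that by (intro le_antisym) (auto simp: sup_le_iff intro!: sup_upper)
    then have "f y = \<Squnion>\<^bsub>F\<^esub>(f ` {x, y})" using that f(2)[of "{x, y}"] by auto
    then show ?thesis using that F.sup_upper[of "f ` {x, y}" "f x"] f(1) by auto
  qed
  have fr: "f r \<sqsubseteq>\<^bsub>F\<^esub> u"
    using u f(1) by (auto simp: r_def f(2) intro!: F.sup_least simp: Upper_def)
  have *: "z \<sqsubseteq> r \<longleftrightarrow> f z \<sqsubseteq>\<^bsub>F\<^esub> u" if z: "z \<in> carrier Q" for z
  proof
    assume "z \<sqsubseteq> r"
    then show "f z \<sqsubseteq>\<^bsub>F\<^esub> u" using mono[of z r] fr F.le_trans[of "f z" "f r" u] z rc u f(1) by auto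
  next
    assume "f z \<sqsubseteq>\<^bsub>F\<^esub> u"
    then show "z \<sqsubseteq> r" using z by (auto simp: r_def intro!: sup_upper)
  qed
  have comm: "x \<sqinter>\<^bsub>F\<^esub> y = y \<sqinter>\<^bsub>F\<^esub> x" for x y by (simp add: meet_def insert_commute)
  have idem: "x \<sqinter>\<^bsub>F\<^esub> x = x" if "x \<in> carrier F" for x
    using that by (intro F.le_antisym F.meet_left F.meet_le) auto
  have ctx: "\<exists>w\<in>carrier F. \<forall>z\<in>carrier Q. f (k z) = f z \<sqinter>\<^bsub>F\<^esub> w" if "k \<in> ctx" for k
    using that
  proof induction
    case ctx_id
    have "f z \<sqinter>\<^bsub>F\<^esub> \<top>\<^bsub>F\<^esub> = f z" if "z \<in> carrier Q" for z
      using that f(1) by (intro F.le_antisym F.meet_left F.meet_le) auto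
    then show ?case by (intro bexI[of _ "\<top>\<^bsub>F\<^esub>"]) simp_all
  next
    case (ctx_l k c)
    then obtain w where w: "w \<in> carrier F" "\<And>z. z \<in> carrier Q \<Longrightarrow> f (k z) = f z \<sqinter>\<^bsub>F\<^esub> w" by blast
    have "f (c \<star> k z) = f z \<sqinter>\<^bsub>F\<^esub> (w \<sqinter>\<^bsub>F\<^esub> f c)" if "z \<in> carrier Q" for z
      using that w ctx_l.hyps F.meet_assoc[of "f z" w "f c"]
      by (simp add: f(1,3) ctx_closed comm[of "f c" "f z \<sqinter>\<^bsub>F\<^esub> w"])
    then show ?case
      using w(1) f(1)[OF ctx_l.hyps(2)] by (intro bexI[of _ "w \<sqinter>\<^bsub>F\<^esub> f c"]) simp_all
  next
    case (ctx_r k c)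
    then obtain w where w: "w \<in> carrier F" "\<And>z. z \<in> carrier Q \<Longrightarrow> f (k z) = f z \<sqinter>\<^bsub>F\<^esub> w" by blast
    have "f (k z \<star> c) = f z \<sqinter>\<^bsub>F\<^esub> (w \<sqinter>\<^bsub>F\<^esub> f c)" if "z \<in> carrier Q" for z
      using that w ctx_r.hyps F.meet_assoc[of "f z" w "f c"]
      by (simp add: f(1,3) ctx_closed)
    then show ?case
      using w(1) f(1)[OF ctx_r.hyps(2)] by (intro bexI[of _ "w \<sqinter>\<^bsub>F\<^esub> f c"]) simp_all
  qed
  have "f (k (a \<star> b)) = f (k (b \<star> a))" "f (k (a \<star> a)) = f (k a)" "f (k (a \<star> b)) \<sqsubseteq>\<^bsub>F\<^esub> f (k a)"
    if k: "k \<in> ctx" and a: "a \<in> carrier Q" and b: "b \<in> carrier Q" for k a b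
  proof -
    obtain w where w: "w \<in> carrier F" "\<And>z. z \<in> carrier Q \<Longrightarrow> f (k z) = f z \<sqinter>\<^bsub>F\<^esub> w"
      using ctx[OF k] by blast
    show "f (k (a \<star> b)) = f (k (b \<star> a))" "f (k (a \<star> a)) = f (k a)"
      using a b w by (simp_all add: qmult_closed f(3) f(1) idem comm[of "f b" "f a"])
    have c: "f a \<in> carrier F" "f b \<in> carrier F" "f a \<sqinter>\<^bsub>F\<^esub> f b \<in> carrier F"
      using a b f(1) by auto
    have "(f a \<sqinter>\<^bsub>F\<^esub> f b) \<sqinter>\<^bsub>F\<^esub> w \<sqsubseteq>\<^bsub>F\<^esub> f a"
      using F.le_trans[OF F.meet_left F.meet_left] c w by simp
    then have "(f a \<sqinter>\<^bsub>F\<^esub> f b) \<sqinter>\<^bsub>F\<^esub> w \<sqsubseteq>\<^bsub>F\<^esub> f a \<sqinter>\<^bsub>F\<^esub> w"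
      using c w by (intro F.meet_le F.meet_right) auto
    then show "f (k (a \<star> b)) \<sqsubseteq>\<^bsub>F\<^esub> f (k a)"
      using a b w by (simp add: qmult_closed f(3))
  qed
  note E = this
  have fc: "f (k z) \<in> carrier F" if "k \<in> ctx" "z \<in> carrier Q" for k z
    by (rule f(1)[OF ctx_closed[OF that]])
  have "r \<in> localic"
  proof (rule localicI)
    fix k a b assume k: "k \<in> ctx" and a: "a \<in> carrier Q" and b: "b \<in> carrier Q"
    show "k (b \<star> a) \<sqsubseteq> r" if "k (a \<star> b) \<sqsubseteq> r"
      using that E(1)[OF k a b] by (simp add: * ctx_closed k a b qmult_closed)
    show "k a \<sqsubseteq> r" if "k (a \<star> a) \<sqsubseteq> r"
      using that E(2)[OF k a a] by (simp add: * ctx_closed k a qmult_closed)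
    show "k (a \<star> b) \<sqsubseteq> r" if "k a \<sqsubseteq> r"
      using that F.le_trans[OF E(3)[OF k a b], of u] fc[OF k] u
      by (simp add: * ctx_closed k a b qmult_closed)
  qed (rule rc)
  then show ?thesis using * that by blast
qed

theorem Spc_universal:
  assumes F: "frame F"
  shows "universal_to Q Spc nuc F"
  unfolding universal_to_def
proof
  fix f assume fs: "f \<in> strong_hom Q (frame_quantale F)"
  interpret F: frame F by fact
  note f = strong_homD[OF fs, simplified]
  define g where "g = restrict f localic"
  have fn: "f (nuc a) = f a" if a: "a \<in> carrier Q" for a
  proof (rule F.le_antisym)
    have fa: "f a \<in> carrier F" "f (nuc a) \<in> carrier F" using a f(1) nuc_carrier by auto
    obtain r where r: "r \<in> localic" "\<And>z. z \<in> carrier Q \<Longrightarrow> z \<sqsubseteq> r \<longleftrightarrow> f z \<sqsubseteq>\<^bsub>F\<^esub> f a"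
      using adjoint_localic[OF F fs fa(1)] by blast
    then show "f (nuc a) \<sqsubseteq>\<^bsub>F\<^esub> f a"
      using a fa nuc_carrier nuc_le_iff[OF a r(1)] by auto
    obtain s where s: "s \<in> localic" "\<And>z. z \<in> carrier Q \<Longrightarrow> z \<sqsubseteq> s \<longleftrightarrow> f z \<sqsubseteq>\<^bsub>F\<^esub> f (nuc a)"
      using adjoint_localic[OF F fs fa(2)] by blast
    then show "f a \<sqsubseteq>\<^bsub>F\<^esub> f (nuc a)"
      using a fa nuc_carrier nuc_le_iff[OF a s(1)] by auto
  qed (use a f(1) nuc_carrier in auto)
  have "g (\<Squnion>\<^bsub>Spc\<^esub>M) = \<Squnion>\<^bsub>F\<^esub>(g ` M)" if M: "M \<subseteq> localic" for M
  proof -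
    have M': "M \<subseteq> carrier Q" using M localic_carrier by auto
    have "g ` M = f ` M" using M by (auto simp: g_def subset_iff image_iff)
    then show ?thesis using M' M by (simp add: Spc_sup g_def nuc_localic fn f(2))
  qed
  moreover have "g (x \<sqinter>\<^bsub>Spc\<^esub> y) = g x \<sqinter>\<^bsub>F\<^esub> g y" if "x \<in> localic" "y \<in> localic" for x y
  proof -
    have c: "x \<in> carrier Q" "y \<in> carrier Q" using that localic_carrier by auto
    have "x \<sqinter>\<^bsub>Spc\<^esub> y = nuc (x \<star> y)" using nuc_mult[OF c] that by (simp add: nuc_fix)
    then show ?thesis using c that by (simp add: g_def nuc_localic qmult_closed fn f(3))
  qed
  moreover have "g \<in> localic \<rightarrow>\<^sub>E carrier F" using f(1) localic_carrier by (auto simp: g_def)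
  ultimately have gs: "g \<in> strong_hom (frame_quantale Spc) (frame_quantale F)"
    by (simp add: strong_hom_def sup_pres_def frame_quantale_complete F Spc.frame_axioms)
  show "\<exists>!g. g \<in> strong_hom (frame_quantale Spc) (frame_quantale F) \<and> compose (carrier Q) g nuc = f"
  proof (rule ex1I[of _ g], intro conjI gs)
    show "compose (carrier Q) g nuc = f"
      using f(4) by (auto simp: compose_def g_def fn nuc_localic extensional_def)
    fix h assume h: "h \<in> strong_hom (frame_quantale Spc) (frame_quantale F) \<and> compose (carrier Q) h nuc = f"
    have "h x = g x" if "x \<in> localic" for x
      using h that localic_carrier nuc_fix[OF that] by (auto simp: g_def compose_eq subset_iff)
    moreover have "h \<in> extensional localic" using h strong_homD(4) by force
    ultimately show "h = g"
      by (intro extensionalityI[of h localic g]) (auto simp: g_def)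
  qed
qed

theorem is_spectrum_exists: "is_spectrum Q Spc nuc"
  by (simp add: is_spectrum_def Spc.frame_axioms nuc_strong Spc_universal)

theorem is_spectrum_universal:
  fixes F :: "'g gorder" and S :: "'f gorder"
  assumes spec: "is_spectrum Q S \<phi>" and F: "frame F"
  shows "universal_to Q S \<phi> F"
  unfolding universal_to_def
proof
  fix f assume f: "f \<in> strong_hom Q (frame_quantale F)"
  let ?c = "compose (carrier Q)" and ?S = "frame_quantale S" and ?Z = "frame_quantale Spc"
  let ?F = "frame_quantale F"
  have S: "frame S" and \<phi>: "\<phi> \<in> strong_hom Q ?S"
    and UQ: "universal_to Q S \<phi> Spc" and US: "universal_to Q S \<phi> S"
    using spec Spc.frame_axioms by (auto simp: is_spectrum_def)
  obtain r where r: "r \<in> strong_hom ?S ?Z" "?c r \<phi> = nuc"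
    using UQ nuc_strong unfolding universal_to_def by blast
  obtain s where s: "s \<in> strong_hom ?Z ?S" "?c s nuc = \<phi>"
    using Spc_universal[OF S] \<phi> unfolding universal_to_def by blast
  obtain h where h: "h \<in> strong_hom ?Z ?F" "?c h nuc = f"
    using Spc_universal[OF F] f unfolding universal_to_def by blast
  have QS: "quantale ?S" and QZ: "quantale ?Z"
    using frame_is_quantale S Spc.frame_axioms by auto
  have cc: "?c (compose (carrier S) v w) \<phi> = ?c v (?c w \<phi>)" for v w
    using strong_homD(1)[OF \<phi>] by (auto simp: compose_def fun_eq_iff)
  have cc': "?c (compose localic v w) nuc = ?c v (?c w nuc)" for v w
    using nuc_localic by (auto simp: compose_def fun_eq_iff)
  have sr: "s (r x) = x" if x: "x \<in> carrier S" for x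
  proof -
    have "compose (carrier S) s r \<in> strong_hom ?S ?S"
      using strong_hom_compose[OF QS r(1) s(1)] by simp
    moreover have "?c (compose (carrier S) s r) \<phi> = \<phi>" by (simp add: cc r s)
    moreover have "(\<lambda>x\<in>carrier S. x) \<in> strong_hom ?S ?S"
    proof -
      interpret S: frame S by fact
      have "(\<lambda>x\<in>carrier S. x) ` M = M" if "M \<subseteq> carrier S" for M using that by (force simp: subset_iff)
      then show ?thesis
        by (simp add: strong_hom_def sup_pres_def frame_quantale_complete S)
    qed
    moreover have "?c (\<lambda>x\<in>carrier S. x) \<phi> = \<phi>"
      using strong_homD(1,4)[OF \<phi>] by (auto simp: compose_def extensional_def)
    ultimately have "compose (carrier S) s r = (\<lambda>x\<in>carrier S. x)"
      using US \<phi> unfolding universal_to_def by blast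
    from fun_cong[OF this, of x] show ?thesis using x by (simp add: compose_eq)
  qed
  show "\<exists>!g. g \<in> strong_hom ?S ?F \<and> ?c g \<phi> = f"
  proof (rule ex1I[of _ "compose (carrier S) h r"], intro conjI)
    show "compose (carrier S) h r \<in> strong_hom ?S ?F"
      using strong_hom_compose[OF QS r(1) h(1)] by simp
    show "?c (compose (carrier S) h r) \<phi> = f" by (simp add: cc r h)
    fix g assume g: "g \<in> strong_hom ?S ?F \<and> ?c g \<phi> = f"
    have "compose localic g s \<in> strong_hom ?Z ?F"
      using strong_hom_compose[OF QZ s(1), of g] g by simp
    moreover have "?c (compose localic g s) nuc = f" using g by (simp add: cc' s)
    ultimately have gs: "compose localic g s = h"
      using Spc_universal[OF F] f h unfolding universal_to_def by blast
    have "g x = h (r x)" if x: "x \<in> carrier S" for x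
      using fun_cong[OF gs, of "r x"] strong_homD(1)[OF r(1), of x] x
      by (simp add: compose_eq sr)
    moreover have "g \<in> extensional (carrier S)" using g strong_homD(4) by force
    ultimately show "g = compose (carrier S) h r"
      by (intro extensionalityI[of g "carrier S"]) (auto simp: compose_eq compose_extensional)
  qed
qed

end

end

theory Submission
  imports Defs
begin

text \<open>
  A prime \<open>P\<close> of a quantale is the same thing as a nonzero strong morphism \<open>x \<mapsto> (x \<not>\<le> P)\<close> to the
  two-element frame; \<open>P\<close> is recovered as the join of the kernel. Since \<open>Q \<rightarrow> Spec Q\<close> is initial
  among strong morphisms to frames, \<open>Q\<close> and \<open>Spec Q\<close> have the same strong morphisms to the
  two-element frame, hence the same primes. Primes of a frame are its points, and primes of the
  quantale of flats are the prime ideals, because \<open>[C \<cdot> D] \<subseteq> P\<close> can be tested on elements.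
\<close>

definition two :: "bool gorder"
  where "two = \<lparr>carrier = UNIV, eq = (=), le = (\<le>)\<rparr>"

lemma two_simps [simp]: "carrier two = UNIV" "eq two = (=)" "le two = (\<le>)"
  by (simp_all add: two_def)

lemma suplattice_two: "suplattice two"
proof
  fix M :: "bool set"
  show "\<exists>s. least two s (Upper two M)"
    by (rule exI[of _ "Sup M"]) (auto simp: least_def Upper_def)
qed auto

lemma two_sup [simp]: "\<Squnion>\<^bsub>two\<^esub>M = (True \<in> M)"
proof -
  interpret two: suplattice two by (rule suplattice_two)
  have "least two (True \<in> M) (Upper two M)"
    by (auto simp: least_def Upper_def)
  then show ?thesis
    using two.sup_lub[of M] two.least_unique by simp
qed

lemma two_meet [simp]: "x \<sqinter>\<^bsub>two\<^esub> y = (x \<and> y)"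
proof -
  interpret two: suplattice two by (rule suplattice_two)
  show ?thesis
    using two.meet_left[of x y] two.meet_right[of x y] two.meet_le[of "x \<and> y" x y] by auto
qed

lemma frame_two: "frame two"
  by (intro frame.intro suplattice_two frame_axioms.intro) auto

text \<open>The equivalence carries two conditions: the forward one is primeness, the backward one
  makes the elements below \<open>p\<close> absorb products on both sides. Together they say that
  \<open>x \<mapsto> (x \<not>\<le> p)\<close> is multiplicative.\<close>

definition quantale_primes :: "'q quantale \<Rightarrow> 'q set"
  where "quantale_primes Q = {p \<in> carrier Q. p \<noteq> \<top>\<^bsub>Q\<^esub> \<and>
    (\<forall>x\<in>carrier Q. \<forall>y\<in>carrier Q.
      x \<star>\<^bsub>Q\<^esub> y \<sqsubseteq>\<^bsub>Q\<^esub> p \<longleftrightarrow> x \<sqsubseteq>\<^bsub>Q\<^esub> p \<or> y \<sqsubseteq>\<^bsub>Q\<^esub> p)}"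

text \<open>The formula of \<open>prime_char\<close> at \<open>p = \<top>\<close>. It has to be
  split off because strong morphisms need not preserve the top.\<close>

definition zero_char :: "'q quantale \<Rightarrow> 'q \<Rightarrow> bool"
  where "zero_char Q = (\<lambda>x\<in>carrier Q. False)"

definition prime_char :: "'q quantale \<Rightarrow> 'q \<Rightarrow> 'q \<Rightarrow> bool"
  where "prime_char Q p = (\<lambda>x\<in>carrier Q. \<not> x \<sqsubseteq>\<^bsub>Q\<^esub> p)"

context quantale
begin

text \<open>A join fails to lie below \<open>p\<close> exactly when one of its members does.\<close>

lemma prime_char_strong:
  assumes p: "p \<in> quantale_primes Q"
  shows "prime_char Q p \<in> strong_hom Q (frame_quantale two)"
proof -
  have "prime_char Q p (\<Squnion>M) = (True \<in> prime_char Q p ` M)" if M: "M \<subseteq> carrier Q" for M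
    using p M sup_le_iff[OF M, of p]
    by (auto simp: prime_char_def quantale_primes_def image_iff subset_iff)
  moreover have "prime_char Q p (x \<star> y) = (prime_char Q p x \<and> prime_char Q p y)"
    if "x \<in> carrier Q" "y \<in> carrier Q" for x y
    using p that by (simp add: prime_char_def quantale_primes_def qmult_closed)
  ultimately show ?thesis
    using complete_lattice_axioms frame_quantale_complete[OF frame_two]
    by (simp add: strong_hom_def sup_pres_def) (simp add: prime_char_def)
qed

lemma prime_char_neq_zero:
  assumes p: "p \<in> quantale_primes Q"
  shows "prime_char Q p \<noteq> zero_char Q"
proof
  assume "prime_char Q p = zero_char Q"
  from fun_cong[OF this, of \<top>] have "\<top> \<sqsubseteq> p"
    by (simp add: prime_char_def zero_char_def)
  then show False
    using p le_antisym[of p \<top>] by (auto simp: quantale_primes_def)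
qed

text \<open>Each element is below itself, so the common character is false at both primes, and each
  lies below the other.\<close>

lemma prime_char_inj: "inj_on (prime_char Q) (quantale_primes Q)"
proof (rule inj_onI)
  fix p q assume pq: "p \<in> quantale_primes Q" "q \<in> quantale_primes Q"
    and eq: "prime_char Q p = prime_char Q q"
  have c: "p \<in> carrier Q" "q \<in> carrier Q"
    using pq by (auto simp: quantale_primes_def)
  show "p = q"
    using fun_cong[OF eq, of p] fun_cong[OF eq, of q] c
    by (intro le_antisym) (auto simp: prime_char_def)
qed

lemma strong_hom_two_prime_char:
  assumes f: "f \<in> strong_hom Q (frame_quantale two)" and nz: "f \<noteq> zero_char Q"
  obtains p where "p \<in> quantale_primes Q" "f = prime_char Q p"
proof -
  note f = strong_homD[OF f, simplified]
  define p where "p = \<Squnion>{z \<in> carrier Q. \<not> f z}"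
  have pc: "p \<in> carrier Q" by (auto simp: p_def)
  \<comment> \<open>A join of elements sent to \<open>False\<close> is sent to \<open>False\<close>,
    so the kernel has \<open>p\<close> as its largest element.\<close>
  have fp: "\<not> f p" by (auto simp: p_def f(2))
  have le: "x \<sqsubseteq> p \<longleftrightarrow> \<not> f x" if x: "x \<in> carrier Q" for x
  proof
    assume "\<not> f x"
    then show "x \<sqsubseteq> p" using x by (auto simp: p_def intro!: sup_upper)
  next
    assume "x \<sqsubseteq> p"
    \<comment> \<open>Monotonicity of \<open>f\<close> comes from preservation of this two-element
      join.\<close>
    then have "\<Squnion>{x, p} = p"
      using x pc by (intro le_antisym) (auto simp: sup_le_iff intro!: sup_upper)
    then show "\<not> f x" using f(2)[of "{x, p}"] x pc fp by auto
  qed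
  have "p \<noteq> \<top>"
  proof
    assume "p = \<top>"
    then have "\<not> f x" if "x \<in> carrier Q" for x
      using le[OF that] top_higher that by simp
    then have "f = zero_char Q"
      using f(4) by (auto simp: zero_char_def extensional_def fun_eq_iff)
    with nz show False ..
  qed
  then have "p \<in> quantale_primes Q"
    using pc by (simp add: quantale_primes_def le qmult_closed f(3))
  moreover have "f = prime_char Q p"
    using f(4) by (auto simp: prime_char_def le extensional_def fun_eq_iff)
  ultimately show ?thesis by (rule that)
qed

lemma prime_char_bij:
  "bij_betw (prime_char Q) (quantale_primes Q)
    (strong_hom Q (frame_quantale two) - {zero_char Q})"
  unfolding bij_betw_def
  using prime_char_inj prime_char_strong prime_char_neq_zero strong_hom_two_prime_char
  by (auto simp: image_iff) metis

text \<open>Existence in the universal property gives surjectivity and uniqueness gives injectivity.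
  The zero characters correspond to each other, so both can be removed.\<close>

lemma spectrum_char_bij:
  assumes spec: "is_spectrum Q S \<phi>"
  shows "bij_betw (\<lambda>g. compose (carrier Q) g \<phi>)
    (strong_hom (frame_quantale S) (frame_quantale two) - {zero_char (frame_quantale S)})
    (strong_hom Q (frame_quantale two) - {zero_char Q})"
proof -
  let ?H = "strong_hom (frame_quantale S) (frame_quantale two)"
  have \<phi>: "\<phi> \<in> strong_hom Q (frame_quantale S)" and S: "frame S"
    using spec by (auto simp: is_spectrum_def)
  have into: "compose (carrier Q) g \<phi> \<in> strong_hom Q (frame_quantale two)" if "g \<in> ?H" for g
    using strong_hom_compose[OF quantale_axioms \<phi> that] .
  \<comment> \<open>\<open>two\<close> lives on \<open>bool\<close>, whereas
    \<open>is_spectrum\<close> tests only frames on the types of \<open>Q\<close> and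
    \<open>S\<close>; hence the appeal to \<open>is_spectrum_universal\<close>.\<close>
  have ex1: "\<exists>!g. g \<in> ?H \<and> compose (carrier Q) g \<phi> = f"
    if "f \<in> strong_hom Q (frame_quantale two)" for f
    using is_spectrum_universal[OF spec frame_two] that unfolding universal_to_def by blast
  have bij: "bij_betw (\<lambda>g. compose (carrier Q) g \<phi>) ?H (strong_hom Q (frame_quantale two))"
    unfolding bij_betw_def inj_on_def using into ex1 by (auto simp: image_iff) metis+
  interpret S: frame S by fact
  have zero: "zero_char (frame_quantale S) \<in> ?H"
    using frame_quantale_complete[OF S] frame_quantale_complete[OF frame_two]
    by (auto simp: strong_hom_def sup_pres_def zero_char_def subset_iff)
  moreover have "compose (carrier Q) (zero_char (frame_quantale S)) \<phi> = zero_char Q"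
    using strong_homD(1)[OF \<phi>] by (auto simp: zero_char_def compose_def fun_eq_iff)
  ultimately show ?thesis
    using zero into[OF zero] by (intro bij_betw_DiffI[OF bij] bij_betw_singletonI) auto
qed

end

text \<open>A meet lies below both its arguments, so absorption is automatic.\<close>

lemma quantale_primes_frame:
  assumes "frame F"
  shows "quantale_primes (frame_quantale F) = points F"
proof -
  interpret F: frame F by fact
  have top: "\<top>\<^bsub>frame_quantale F\<^esub> = \<top>\<^bsub>F\<^esub>"
    by (simp add: top_def)
  have "x \<sqinter>\<^bsub>F\<^esub> y \<sqsubseteq>\<^bsub>F\<^esub> p" if "x \<sqsubseteq>\<^bsub>F\<^esub> p \<or> y \<sqsubseteq>\<^bsub>F\<^esub> p"
    "x \<in> carrier F" "y \<in> carrier F" "p \<in> carrier F" for x y p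
    using that F.meet_left[of x y] F.meet_right[of x y] F.le_trans[of "x \<sqinter>\<^bsub>F\<^esub> y"] by auto
  then show ?thesis
    unfolding quantale_primes_def points_def top frame_quantale_simps by blast
qed

context covered_semigroup
begin

lemma flat_top: "\<top>\<^bsub>flat_quantale A\<^esub> = carrier A"
proof -
  have "carrier A \<in> flats A"
    using cl_closed[of "carrier A"] cl_extensive[of "carrier A"] by (auto simp: flats_def)
  then have "greatest (flat_quantale A) (carrier A) (flats A)"
    by (auto simp: greatest_def flat_quantale_def flats_def)
  then show ?thesis
    using flat.top_greatest flat.greatest_unique by blast
qed

lemma cl_subset_iff: "\<lbrakk>S \<subseteq> carrier A; p \<in> flats A\<rbrakk> \<Longrightarrow> cl A S \<subseteq> p \<longleftrightarrow> S \<subseteq> p"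
  using cl_extensive cl_least by blast

lemma prime_ideals_flat_quantale: "quantale_primes (flat_quantale A) = prime_ideals A"
proof (intro equalityI subsetI)
  fix p assume "p \<in> quantale_primes (flat_quantale A)"
  then have p: "p \<in> flats A" "p \<noteq> carrier A"
    and pr: "\<And>C D. \<lbrakk>C \<in> flats A; D \<in> flats A\<rbrakk> \<Longrightarrow> cl A (C \<odot> D) \<subseteq> p \<longleftrightarrow> C \<subseteq> p \<or> D \<subseteq> p"
    by (auto simp: quantale_primes_def flat_top) (auto simp: flat_quantale_def)
  have pc: "p \<subseteq> carrier A" using p by (simp add: flats_def)
  have A: "carrier A \<in> flats A" using flat.top_closed by (simp add: flat_top)
  \<comment> \<open>Absorption is the prime condition with one factor \<open>p\<close> and the other
    the top flat.\<close>
  have "carrier A \<odot> p \<subseteq> p" "p \<odot> carrier A \<subseteq> p"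
    using pr[OF A p(1)] pr[OF p(1) A] cl_subset_iff[OF set_prod_carrier p(1)] pc by auto
  moreover have "x \<in> p \<or> y \<in> p" if xy: "x \<in> carrier A" "y \<in> carrier A" "x \<cdot> y \<in> p" for x y
  proof -
    \<comment> \<open>Elements are replaced by the flats they generate; the closed product of these
      is the flat generated by \<open>x \<cdot> y\<close>.\<close>
    have "cl A (cl A {x} \<odot> cl A {y}) = cl A ({x} \<odot> {y})"
      using xy by (intro cl_set_prod_cl) auto
    also have "\<dots> \<subseteq> p"
      using xy p(1) by (intro cl_least) (auto simp: set_prod_def)
    finally have "cl A {x} \<subseteq> p \<or> cl A {y} \<subseteq> p"
      using xy pr by (simp add: cl_flat)
    then show ?thesis
      using xy p(1) by (simp add: cl_subset_iff)
  qed
  ultimately show "p \<in> prime_ideals A"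
    using p by (auto simp: prime_ideals_def ideals_def)
next
  fix p assume "p \<in> prime_ideals A"
  then have p: "p \<in> flats A" "p \<noteq> carrier A" "carrier A \<odot> p \<subseteq> p" "p \<odot> carrier A \<subseteq> p"
    and pr: "\<And>x y. \<lbrakk>x \<in> carrier A; y \<in> carrier A; x \<cdot> y \<in> p\<rbrakk> \<Longrightarrow> x \<in> p \<or> y \<in> p"
    by (auto simp: prime_ideals_def ideals_def)
  have "cl A (C \<odot> D) \<subseteq> p \<longleftrightarrow> C \<subseteq> p \<or> D \<subseteq> p" if CD: "C \<in> flats A" "D \<in> flats A" for C D
  proof -
    have c: "C \<subseteq> carrier A" "D \<subseteq> carrier A" using CD by (auto simp: flats_def)
    have "C \<odot> D \<subseteq> p" if "C \<subseteq> p \<or> D \<subseteq> p"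
      using that c p(3,4) set_prod_mono[of C p D "carrier A"] set_prod_mono[of C "carrier A" D p]
      by blast
    \<comment> \<open>If neither flat lies in \<open>p\<close>, elements of \<open>C\<close> and
      \<open>D\<close> outside \<open>p\<close> have their product in \<open>p\<close>, against
      primeness.\<close>
    moreover have "C \<subseteq> p \<or> D \<subseteq> p" if CDp: "C \<odot> D \<subseteq> p"
    proof (rule ccontr)
      assume "\<not> (C \<subseteq> p \<or> D \<subseteq> p)"
      then obtain x y where xy: "x \<in> C" "x \<notin> p" "y \<in> D" "y \<notin> p" by blast
      then have "x \<cdot> y \<in> p" using CDp by (auto simp: set_prod_def)
      then show False using pr[of x y] xy c by auto
    qed
    ultimately show ?thesis
      using cl_subset_iff[OF set_prod_carrier[OF c] p(1)] by blast
  qed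
  then show "p \<in> quantale_primes (flat_quantale A)"
    using p by (simp add: quantale_primes_def flat_top) (simp add: flat_quantale_def)
qed

end

theorem proposition2p45:
  fixes A :: "'a covered" and S :: "'f gorder" and \<phi> :: "'a set \<Rightarrow> 'f"
  assumes "covered_semigroup A"
    and "is_spectrum (flat_quantale A) S \<phi>"
  shows "\<exists>h. bij_betw h (prime_ideals A) (points S)"
proof -
  interpret covered_semigroup A by fact
  let ?Q = "flat_quantale A" and ?S = "frame_quantale S" and ?two = "frame_quantale two"
  have S: "frame S" using assms(2) by (simp add: is_spectrum_def)
  have Q: "bij_betw (prime_char ?Q) (prime_ideals A) (strong_hom ?Q ?two - {zero_char ?Q})"
    using quantale.prime_char_bij[OF flat_quantale] by (simp add: prime_ideals_flat_quantale)
  have P: "bij_betw (prime_char ?S) (points S) (strong_hom ?S ?two - {zero_char ?S})"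
    using quantale.prime_char_bij[OF frame_is_quantale[OF S]]
    by (simp add: quantale_primes_frame[OF S])
  \<comment> \<open>Points of \<open>S\<close> are sent to characters of \<open>?S\<close> and then,
    by composition with \<open>\<phi>\<close>, to characters of \<open>?Q\<close>. The inverse of
    this bijection is applied after \<open>Q\<close>.\<close>
  note bij_betw_trans[OF P quantale.spectrum_char_bij[OF flat_quantale assms(2)]]
  from bij_betw_trans[OF Q bij_betw_inv_into[OF this]] show ?thesis by blast
qed

end
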